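(* Suppose $X$ is a metrizable space and $h:X\to X$ is a compactly almost periodic homeomorphism. Then the sets of the form $\overline{\{h^{n}(x) : n\in\mathbb{Z}\}}$, $x\in X$, determine a continuous decomposition of $X$ into compact abelian groups; that is, these sets form a continuous decomposition of $X$, and each of them, with the subspace topology, is compact and admits the structure of an abelian topological group.
   Context: A homeomorphism $h$ of a metric space $(X,d)$ is almost periodic if for each $\varepsilon>0$ there is an integer $N\ge 0$ such that for every $M\in\mathbb{Z}$ there is an integer $i$ with $M\le i\le M+N$ and $d(h^{i}(x),x)<\varepsilon$ for all $x\in X$. A homeomorphism $h$ of a metrizable space $X$ is compactly almost periodic if (i) $\overline{\bigcup_{n\in\mathbb{Z}}h^{n}(B)}$ is compact for each compact $B\subset X$, and (ii) for each compact $A\subset X$ with $h(A)=A$, the restriction $h|_{A}:A\to A$ is an almost periodic homeomorphism of $A$ (with respect to a metric on $A$ inducing its topology; since $A$ is compact the choice of metric is immaterial). A decomposition $X^{*}$ of a topological space $X$ is a collection of disjoint closed subsets of $X$ whose union is $X$; $X^*$ is given the quotient topology. The decomposition is continuous (that is, both upper semicontinuous and lower semicontinuous) if the natural quotient map $\pi:X\to X^{*}$ is both an open map and a closed map. *)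

theory Defs
  imports "HOL-Analysis.Analysis" "HOL-Algebra.Group"
begin

text \<open>
  \<open>int_iter S h n\<close> is \<open>h\<^sup>n\<close> for a bijection \<open>h\<close> of the carrier set \<open>S\<close> onto itself and an
  arbitrary integer \<open>n\<close>; it is only meaningful at points of \<open>S\<close>.
\<close>

definition int_iter :: "'a set \<Rightarrow> ('a \<Rightarrow> 'a) \<Rightarrow> int \<Rightarrow> 'a \<Rightarrow> 'a" where
  "int_iter S h n =
     (if 0 \<le> n then h ^^ nat n else inv_into S h ^^ nat (- n))"

definition almost_periodic_homeomorphism ::
    "'a set \<Rightarrow> ('a \<Rightarrow> 'a \<Rightarrow> real) \<Rightarrow> ('a \<Rightarrow> 'a) \<Rightarrow> bool" where
  "almost_periodic_homeomorphism S d h \<longleftrightarrow>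
     Metric_space S d \<and>
     homeomorphic_map (Metric_space.mtopology S d) (Metric_space.mtopology S d) h \<and>
     (\<forall>\<epsilon>>0. \<exists>N::int. 0 \<le> N \<and>
        (\<forall>M::int. \<exists>i. M \<le> i \<and> i \<le> M + N \<and> (\<forall>x\<in>S. d (int_iter S h i x) x < \<epsilon>)))"

text \<open>
  The metric in the second clause is existentially quantified; as \<open>A\<close> is compact, almost
  periodicity does not depend on which metric inducing the topology is chosen.
\<close>

definition compactly_almost_periodic :: "'a topology \<Rightarrow> ('a \<Rightarrow> 'a) \<Rightarrow> bool" where
  "compactly_almost_periodic X h \<longleftrightarrow>
     homeomorphic_map X X h \<and>
     (\<forall>B. compactin X B \<longrightarrow>
        compactin X (X closure_of (\<Union>n::int. int_iter (topspace X) h n ` B))) \<and>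
     (\<forall>A. compactin X A \<and> h ` A = A \<longrightarrow>
        (\<exists>d. Metric_space A d \<and> Metric_space.mtopology A d = subtopology X A \<and>
             almost_periodic_homeomorphism A d h))"

definition orbit_closure :: "'a topology \<Rightarrow> ('a \<Rightarrow> 'a) \<Rightarrow> 'a \<Rightarrow> 'a set" where
  "orbit_closure X h x = X closure_of {int_iter (topspace X) h n x | n::int. True}"

definition decomposition :: "'a topology \<Rightarrow> 'a set set \<Rightarrow> bool" where
  "decomposition X D \<longleftrightarrow> partition_on (topspace X) D \<and> (\<forall>A\<in>D. closedin X A)"

definition decomposition_map :: "'a set set \<Rightarrow> 'a \<Rightarrow> 'a set" where
  "decomposition_map D x = (THE A. A \<in> D \<and> x \<in> A)"

definition decomposition_topology :: "'a topology \<Rightarrow> 'a set set \<Rightarrow> 'a set topology" where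
  "decomposition_topology X D =
     topology (\<lambda>U. U \<subseteq> D \<and> openin X {x \<in> topspace X. decomposition_map D x \<in> U})"

lemma openin_decomposition_topology:
  "openin (decomposition_topology X D) U \<longleftrightarrow>
     U \<subseteq> D \<and> openin X {x \<in> topspace X. decomposition_map D x \<in> U}"
proof -
  have "istopology (\<lambda>U. U \<subseteq> D \<and> openin X {x \<in> topspace X. decomposition_map D x \<in> U})"
    unfolding istopology_def
  proof (intro conjI allI impI)
    fix S T
    assume "S \<subseteq> D \<and> openin X {x \<in> topspace X. decomposition_map D x \<in> S}"
      and "T \<subseteq> D \<and> openin X {x \<in> topspace X. decomposition_map D x \<in> T}"
    moreover have "{x \<in> topspace X. decomposition_map D x \<in> S \<inter> T} =
        {x \<in> topspace X. decomposition_map D x \<in> S} \<inter>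
        {x \<in> topspace X. decomposition_map D x \<in> T}"
      by blast
    ultimately show "S \<inter> T \<subseteq> D"
      and "openin X {x \<in> topspace X. decomposition_map D x \<in> S \<inter> T}"
      by auto
  next
    fix \<K>
    assume K: "\<forall>K\<in>\<K>. K \<subseteq> D \<and> openin X {x \<in> topspace X. decomposition_map D x \<in> K}"
    then show "\<Union>\<K> \<subseteq> D"
      by blast
    have "{x \<in> topspace X. decomposition_map D x \<in> \<Union>\<K>} =
        (\<Union>K\<in>\<K>. {x \<in> topspace X. decomposition_map D x \<in> K})"
      by blast
    with K show "openin X {x \<in> topspace X. decomposition_map D x \<in> \<Union>\<K>}"
      by auto
  qed
  then show ?thesis
    unfolding decomposition_topology_def by (simp add: topology_inverse')
qed

lemma decomposition_map_eq:
  assumes "decomposition X D" "A \<in> D" "x \<in> A"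
  shows "decomposition_map D x = A"
  unfolding decomposition_map_def
proof (rule the_equality)
  show "A \<in> D \<and> x \<in> A"
    using assms by simp
  show "B = A" if "B \<in> D \<and> x \<in> B" for B
    using that assms unfolding decomposition_def partition_on_def disjoint_def by blast
qed

lemma quotient_map_decomposition_map:
  assumes D: "decomposition X D"
  shows "quotient_map X (decomposition_topology X D) (decomposition_map D)"
proof -
  have mem: "decomposition_map D x \<in> D" if "x \<in> topspace X" for x
    using that D decomposition_map_eq[OF D]
    unfolding decomposition_def partition_on_def by (metis UnionE)
  have "{x \<in> topspace X. decomposition_map D x \<in> D} = topspace X"
    using mem by blast
  then have "openin (decomposition_topology X D) D"
    by (simp add: openin_decomposition_topology)
  then have top: "topspace (decomposition_topology X D) = D"
    by (metis openin_decomposition_topology openin_topspace openin_subset subset_antisym)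
  have "D \<subseteq> decomposition_map D ` topspace X"
  proof
    fix A assume A: "A \<in> D"
    with D obtain x where "x \<in> A" "x \<in> topspace X"
      unfolding decomposition_def partition_on_def by (metis UnionI ex_in_conv)
    with decomposition_map_eq[OF D A] show "A \<in> decomposition_map D ` topspace X"
      by blast
  qed
  with mem have "decomposition_map D ` topspace X = D"
    by blast
  then show ?thesis
    unfolding quotient_map_def top by (simp add: openin_decomposition_topology)
qed

definition continuous_decomposition :: "'a topology \<Rightarrow> 'a set set \<Rightarrow> bool" where
  "continuous_decomposition X D \<longleftrightarrow>
     decomposition X D \<and>
     open_map X (decomposition_topology X D) (decomposition_map D) \<and>
     closed_map X (decomposition_topology X D) (decomposition_map D)"

definition abelian_topological_group :: "('a, 'b) monoid_scheme \<Rightarrow> 'a topology \<Rightarrow> bool" where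
  "abelian_topological_group G T \<longleftrightarrow>
     comm_group G \<and> topspace T = carrier G \<and>
     continuous_map (prod_topology T T) T (\<lambda>(x, y). x \<otimes>\<^bsub>G\<^esub> y) \<and>
     continuous_map T T (\<lambda>x. inv\<^bsub>G\<^esub> x)"

end

theory Submission
  imports Defs
begin

text \<open>
  Everything rests on one fact: on a compact invariant set \<open>A\<close>, the iterates \<open>h\<^sup>n\<close>, \<open>n\<close> ranging over
  the integers, are uniformly equicontinuous (\<open>almost_periodic_imp_equicontinuous\<close>). Indeed each
  \<open>h\<^sup>n\<close> is uniformly close to one of the finitely many maps \<open>h\<^sup>0, ..., h\<^sup>N\<close>, because some almost
  period lies in \<open>[n - N, n]\<close>, and these finitely many maps are uniformly continuous on \<open>A\<close>. The first
  clause of compact almost periodicity supplies enough sets \<open>A\<close>: every compact set lies in a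
  compact invariant one.

  Orbit closures are minimal. If \<open>y\<close> is in the orbit closure of \<open>x\<close>, some \<open>h\<^sup>n x\<close> is close to \<open>y\<close>;
  by equicontinuity \<open>h\<^bsup>-n\<^esup> y\<close> is close to \<open>x\<close>, so \<open>x\<close> is in the orbit closure of \<open>y\<close>
  (\<open>orbit_closure_sym\<close>). Hence the orbit closures partition \<open>X\<close>.

  The quotient map is open because an orbit closure meets an open set exactly if the orbit does, so
  that the saturation of an open \<open>U\<close> is the union of its preimages under the iterates. It is closed
  by a compactness argument (\<open>closedin_saturation\<close>): if \<open>x\<^sub>n\<close> converges to \<open>x\<close> and the orbit closure of
  \<open>x\<^sub>n\<close> meets the closed set \<open>C\<close> in \<open>c\<^sub>n\<close>, all these points lie in one compact invariant set; a
  limit point of \<open>c\<^sub>n\<close> is in \<open>C\<close>, and equicontinuity puts it into the orbit closure of \<open>x\<close>.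

  The group structure on the orbit closure of \<open>x\<close> is the extension of \<open>h\<^sup>a x + h\<^sup>b x = h\<^bsup>a+b\<^esup> x\<close> by
  uniform continuity from the orbit to its closure, which is complete; equicontinuity makes addition
  and negation on the orbit uniformly continuous
  (\<open>abelian_topological_group_from_dense_image\<close>).
\<close>

section \<open>Completing an abelian group along an equicontinuous parametrization\<close>

text \<open>
  The hypothesis \<open>equi\<close> says that translations of the parameter group act on the image of \<open>e\<close>
  uniformly equicontinuously. It forces \<open>e a\<close> and \<open>e b\<close> to determine \<open>e (a + b)\<close>, so the image carries
  a group structure, and it makes the operations uniformly continuous; they therefore extend to
  the complete space, where the group laws persist because they are closed conditions that hold on
  a dense set.
\<close>

lemma abelian_topological_group_from_dense_image:
  fixes m :: "'a metric" and e :: "'g::ab_group_add \<Rightarrow> 'a"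
  assumes complete: "mcomplete_of m"
    and e_in: "\<And>a. e a \<in> mspace m"
    and dense: "mtopology_of m closure_of range e = mspace m"
    and equi: "\<And>\<epsilon>. \<epsilon> > 0 \<Longrightarrow>
      \<exists>\<delta>>0. \<forall>a b c. mdist m (e a) (e b) < \<delta> \<longrightarrow> mdist m (e (a + c)) (e (b + c)) < \<epsilon>"
  shows "\<exists>G :: 'a monoid. abelian_topological_group G (mtopology_of m)"
proof -
  define T where "T = mtopology_of m"
  have top: "topspace T = mspace m"
    by (simp add: T_def)
  have haus: "Hausdorff_space T"
    by (simp add: T_def mtopology_of_def Metric_space.Hausdorff_space_mtopology)
  \<comment> \<open>A choice of parameter for each point of the image; by \<open>shift\<close> below the choice is immaterial.\<close>
  define s where "s = inv_into UNIV e"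
  have es: "e (s (e a)) = e a" for a
    by (simp add: s_def f_inv_into_f)
  have shift: "e (a + c) = e (b + c)" if "e a = e b" for a b c
  proof -
    have "mdist m (e (a + c)) (e (b + c)) < \<epsilon>" if "\<epsilon> > 0" for \<epsilon>
      using equi[OF that] \<open>e a = e b\<close> e_in by (metis mdist_zero)
    then have "mdist m (e (a + c)) (e (b + c)) = 0"
      by (metis less_irrefl mdist_nonneg order_less_le)
    then show ?thesis
      using e_in by simp
  qed
  have mult_e: "e (s (e a) + s (e b)) = e (a + b)" for a b
    by (metis add.commute es shift)
  have inv_e: "e (- s (e a)) = e (- a)" for a
    using shift[OF es[of a], of "- a - s (e a)"] by (simp add: algebra_simps)

  have uni_mult: "uniformly_continuous_map (submetric (prod_metric m m) (range e \<times> range e)) m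
      (\<lambda>(y, z). e (s y + s z))"
    unfolding uniformly_continuous_map_def
  proof (intro conjI allI impI)
    fix \<epsilon> :: real assume "\<epsilon> > 0"
    then obtain \<delta> where "\<delta> > 0"
      and \<delta>: "\<And>a b c. mdist m (e a) (e b) < \<delta> \<Longrightarrow> mdist m (e (a + c)) (e (b + c)) < \<epsilon> / 2"
      using equi[of "\<epsilon> / 2"] by auto
    have "mdist m (e (a + b)) (e (a' + b')) < \<epsilon>"
      if "prod_dist (mdist m) (mdist m) (e a, e b) (e a', e b') < \<delta>" for a b a' b'
    proof -
      \<comment> \<open>Pass from \<open>(a, b)\<close> to \<open>(a', b')\<close> through \<open>(a', b)\<close>, translating once by \<open>b\<close> and once by \<open>a'\<close>.\<close>
      have "mdist m (e a) (e a') < \<delta>" "mdist m (e b) (e b') < \<delta>"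
        using that Metric_space12.component_le_prod_metric[OF Metric_space12_mspace_mdist]
        by (meson le_less_trans)+
      then have "mdist m (e (a + b)) (e (a' + b)) < \<epsilon> / 2"
        "mdist m (e (a' + b)) (e (a' + b')) < \<epsilon> / 2"
        using \<delta>[of a a' b] \<delta>[of b b' a'] by (simp_all add: add.commute)
      then show ?thesis
        using mdist_triangle[OF e_in e_in e_in, of "a + b" "a' + b'" "a' + b"] by linarith
    qed
    then show "\<exists>\<delta>>0. \<forall>x\<in>mspace (submetric (prod_metric m m) (range e \<times> range e)).
        \<forall>y\<in>mspace (submetric (prod_metric m m) (range e \<times> range e)).
        mdist (submetric (prod_metric m m) (range e \<times> range e)) y x < \<delta> \<longrightarrow>
        mdist m (case y of (y, z) \<Rightarrow> e (s y + s z)) (case x of (y, z) \<Rightarrow> e (s y + s z)) < \<epsilon>"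
      using \<open>\<delta> > 0\<close> by (intro exI[of _ \<delta>]) (auto simp: mult_e)
  qed (auto simp: e_in)
  obtain \<mu> where \<mu>: "continuous_map (prod_topology T T) T \<mu>"
    and \<mu>_e: "\<And>a b. \<mu> (e a, e b) = e (a + b)"
  proof -
    obtain g where
      "uniformly_continuous_map (submetric (prod_metric m m)
         (mtopology_of (prod_metric m m) closure_of (range e \<times> range e))) m g"
      and g: "\<And>x. x \<in> range e \<times> range e \<Longrightarrow> g x = (case x of (y, z) \<Rightarrow> e (s y + s z))"
      using uniformly_continuous_map_extends_to_closure_of[OF complete uni_mult] by blast
    then have "uniformly_continuous_map (prod_metric m m) m g"
      by (metis closure_of_Times dense mspace_prod_metric mtopology_of_prod_metric submetric_mspace)
    then show ?thesis
      using that[of g] g mult_e uniformly_continuous_imp_continuous_map unfolding T_def by fastforce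
  qed

  have uni_inv: "uniformly_continuous_map (submetric m (range e)) m (\<lambda>y. e (- s y))"
    unfolding uniformly_continuous_map_def
  proof (intro conjI allI impI)
    fix \<epsilon> :: real assume "\<epsilon> > 0"
    then obtain \<delta> where "\<delta> > 0"
      and \<delta>: "\<And>a b c. mdist m (e a) (e b) < \<delta> \<Longrightarrow> mdist m (e (a + c)) (e (b + c)) < \<epsilon>"
      using equi[of \<epsilon>] by auto
    \<comment> \<open>Translating by \<open>- a - b\<close> turns the pair \<open>(a, b)\<close> into \<open>(- b, - a)\<close>.\<close>
    have "mdist m (e (- b)) (e (- a)) < \<epsilon>" if "mdist m (e a) (e b) < \<delta>" for a b
      using \<delta>[OF that, of "- a - b"] by (simp add: algebra_simps)
    then show "\<exists>\<delta>>0. \<forall>x\<in>mspace (submetric m (range e)). \<forall>y\<in>mspace (submetric m (range e)).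
        mdist (submetric m (range e)) y x < \<delta> \<longrightarrow> mdist m (e (- s y)) (e (- s x)) < \<epsilon>"
      using \<open>\<delta> > 0\<close> by (intro exI[of _ \<delta>]) (auto simp: inv_e mdist_commute)
  qed (auto simp: e_in)
  obtain \<iota> where \<iota>: "continuous_map T T \<iota>" and \<iota>_e: "\<And>a. \<iota> (e a) = e (- a)"
  proof -
    obtain g where
      "uniformly_continuous_map (submetric m (mtopology_of m closure_of range e)) m g"
      and g: "\<And>x. x \<in> range e \<Longrightarrow> g x = e (- s x)"
      using uniformly_continuous_map_extends_to_closure_of[OF complete uni_inv] by blast
    then have "uniformly_continuous_map m m g"
      by (simp add: dense)
    then show ?thesis
      using that[of g] g inv_e uniformly_continuous_imp_continuous_map unfolding T_def by fastforce
  qed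

  have \<mu>_cont: "continuous_map Z T (\<lambda>z. \<mu> (f z, g z))"
    if "continuous_map Z T f" "continuous_map Z T g" for Z :: "'z topology" and f g
    using continuous_map_compose[OF continuous_map_pairedI[OF that] \<mu>] by (simp add: o_def)
  have dense1: "x \<in> T closure_of range e" if "x \<in> mspace m" for x
    using that dense by (simp add: T_def)
  have \<mu>_in: "\<mu> (x, y) \<in> mspace m" if "x \<in> mspace m" "y \<in> mspace m" for x y
    using \<mu> that top unfolding continuous_map_def by (auto simp: Pi_iff)
  have \<iota>_in: "\<iota> x \<in> mspace m" if "x \<in> mspace m" for x
    using \<iota> that top unfolding continuous_map_def by (auto simp: Pi_iff)

  have comm: "\<mu> (x, y) = \<mu> (y, x)" if "x \<in> mspace m" "y \<in> mspace m" for x y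
  proof -
    have mem: "(x, y) \<in> prod_topology T T closure_of (range e \<times> range e)"
      using that by (simp add: closure_of_Times dense1)
    have "\<mu> (x, y) = (\<lambda>p. \<mu> (snd p, fst p)) (x, y)"
      by (rule forall_in_closure_of_eq[OF mem haus \<mu>
            \<mu>_cont[OF continuous_map_snd continuous_map_fst]])
        (auto simp: \<mu>_e add.commute)
    then show ?thesis
      by simp
  qed
  have assoc: "\<mu> (\<mu> (x, y), z) = \<mu> (x, \<mu> (y, z))"
    if "x \<in> mspace m" "y \<in> mspace m" "z \<in> mspace m" for x y z
  proof -
    let ?P = "prod_topology T (prod_topology T T)"
    have mem: "(x, y, z) \<in> ?P closure_of (range e \<times> range e \<times> range e)"
      using that by (simp add: closure_of_Times dense1)
    have p: "continuous_map ?P T fst" "continuous_map ?P T (\<lambda>p. fst (snd p))"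
      "continuous_map ?P T (\<lambda>p. snd (snd p))"
      using continuous_map_compose[OF continuous_map_snd continuous_map_fst, of T T T]
        continuous_map_compose[OF continuous_map_snd continuous_map_snd, of T T T]
      by (simp_all add: continuous_map_fst o_def)
    have "(\<lambda>p. \<mu> (\<mu> (fst p, fst (snd p)), snd (snd p))) (x, y, z) =
        (\<lambda>p. \<mu> (fst p, \<mu> (fst (snd p), snd (snd p)))) (x, y, z)"
      by (rule forall_in_closure_of_eq[OF mem haus \<mu>_cont[OF \<mu>_cont[OF p(1,2)] p(3)]
            \<mu>_cont[OF p(1) \<mu>_cont[OF p(2,3)]]])
        (auto simp: \<mu>_e add.assoc)
    then show ?thesis
      by simp
  qed
  have unit: "\<mu> (e 0, x) = x" if "x \<in> mspace m" for x
  proof (rule forall_in_closure_of_eq[OF dense1[OF that] haus])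
    show "continuous_map T T (\<lambda>x. \<mu> (e 0, x))"
      by (rule \<mu>_cont) (simp_all add: e_in top)
  qed (auto simp: \<mu>_e)
  have linv: "\<mu> (\<iota> x, x) = e 0" if "x \<in> mspace m" for x
  proof (rule forall_in_closure_of_eq[OF dense1[OF that] haus])
    show "continuous_map T T (\<lambda>x. \<mu> (\<iota> x, x))"
      by (rule \<mu>_cont[OF \<iota>]) simp
  qed (auto simp: \<mu>_e \<iota>_e e_in top)

  define G where "G = \<lparr>carrier = mspace m, mult = (\<lambda>x y. \<mu> (x, y)), one = e 0\<rparr>"
  have G: "comm_group G"
    by (rule comm_groupI) (auto simp: G_def \<mu>_in e_in assoc unit intro: comm \<iota>_in linv)
  then interpret comm_group G .
  have "inv\<^bsub>G\<^esub> x = \<iota> x" if "x \<in> mspace m" for x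
    using inv_equality[of "\<iota> x" x] that by (simp add: G_def linv \<iota>_in)
  then have "continuous_map T T (\<lambda>x. inv\<^bsub>G\<^esub> x)"
    using \<iota> top by (metis (no_types, lifting) continuous_map_eq)
  then have "abelian_topological_group G T"
    using G \<mu> top unfolding abelian_topological_group_def by (simp add: G_def)
  then show ?thesis
    unfolding T_def by blast
qed

section \<open>Integer iterates\<close>

context
  fixes S :: "'a set" and h :: "'a \<Rightarrow> 'a"
  assumes bij: "bij_betw h S S"
begin

lemma int_iter_0 [simp]: "int_iter S h 0 x = x"
  by (simp add: int_iter_def)

lemma funpow_inv_into_in: "x \<in> S \<Longrightarrow> (inv_into S h ^^ k) x \<in> S"
  using bij_betwE[OF bij_betw_inv_into[OF bij]] by (induction k) auto

lemma int_iter_in: "x \<in> S \<Longrightarrow> int_iter S h n x \<in> S"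
  using bij_betw_funpow[OF bij] funpow_inv_into_in by (auto simp: int_iter_def dest: bij_betwE)

lemma int_iter_Suc: "x \<in> S \<Longrightarrow> int_iter S h (n + 1) x = h (int_iter S h n x)"
proof (cases "0 \<le> n")
  case True
  then show ?thesis
    by (simp add: int_iter_def nat_add_distrib)
next
  case False
  assume "x \<in> S"
  have *: "nat (- n) = Suc (nat (- (n + 1)))"
    using False by simp
  have "h (int_iter S h n x) = (inv_into S h ^^ nat (- (n + 1))) x"
    using False bij funpow_inv_into_in[OF \<open>x \<in> S\<close>]
    by (simp add: int_iter_def * bij_betw_inv_into_right del: minus_add_distrib)
  with False show ?thesis
    by (auto simp: int_iter_def)
qed

lemma int_iter_add:
  assumes "x \<in> S"
  shows "int_iter S h (a + b) x = int_iter S h a (int_iter S h b x)"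
proof (induction a rule: int_induct[where k = 0])
  case base
  then show ?case by simp
next
  case (step1 i)
  have "int_iter S h (i + 1 + b) x = int_iter S h ((i + b) + 1) x"
    by (simp add: algebra_simps)
  then show ?case
    using step1 int_iter_Suc[OF assms] int_iter_Suc[OF int_iter_in[OF assms]] by metis
next
  case (step2 i)
  have "h (int_iter S h (i - 1 + b) x) = h (int_iter S h (i - 1) (int_iter S h b x))"
    using step2 int_iter_Suc[OF assms, of "i - 1 + b"]
      int_iter_Suc[OF int_iter_in[OF assms], of "i - 1" b] by (simp add: algebra_simps)
  then show ?case
    using bij int_iter_in assms by (auto simp: bij_betw_def dest!: inj_onD)
qed

text \<open>
  The inverse of \<open>h\<close> on \<open>A\<close> and its inverse on \<open>S\<close> are chosen independently; they agree on an invariant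
  set \<open>A\<close>, so that almost periodicity of a restriction speaks about the iterates on the whole space.
\<close>

lemma int_iter_subset:
  assumes "A \<subseteq> S" "h ` A = A" "x \<in> A"
  shows "int_iter A h n x = int_iter S h n x"
    and "int_iter S h n x \<in> A"
proof -
  have inj: "inj_on h S"
    using bij by (simp add: bij_betw_def)
  have step: "inv_into A h y = inv_into S h y \<and> inv_into A h y \<in> A" if "y \<in> A" for y
  proof -
    obtain a where "a \<in> A" "y = h a"
      using \<open>y \<in> A\<close> assms by blast
    then show ?thesis
      using inj assms by (auto simp: inv_into_f_f inj_on_subset subset_iff)
  qed
  have neg: "(inv_into A h ^^ k) x = (inv_into S h ^^ k) x \<and> (inv_into A h ^^ k) x \<in> A" for k
    by (induction k) (simp_all add: assms(3) step, metis step)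
  have pos: "(h ^^ k) x \<in> A" for k
    by (induction k) (use assms in auto)
  show "int_iter A h n x = int_iter S h n x" "int_iter S h n x \<in> A"
    using neg[of "nat (- n)"] pos[of "nat n"] by (auto simp: int_iter_def)
qed

end

lemma homeomorphic_map_imp_bij: "homeomorphic_map X X h \<Longrightarrow> bij_betw h (topspace X) (topspace X)"
  by (simp add: bij_betw_def homeomorphic_imp_injective_map homeomorphic_imp_surjective_map)

lemma continuous_map_int_iter:
  assumes "homeomorphic_map X X h"
  shows "continuous_map X X (int_iter (topspace X) h n)"
proof -
  obtain g where g: "homeomorphic_maps X X h g"
    using assms homeomorphic_map_maps by blast
  have "g y = inv_into (topspace X) h y" if "y \<in> topspace X" for y
    using that g assms homeomorphic_imp_injective_map
    unfolding homeomorphic_maps_def continuous_map_def by (metis Pi_iff inv_into_f_f)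
  then have "continuous_map X X (inv_into (topspace X) h)"
    using g unfolding homeomorphic_maps_def by (metis continuous_map_eq)
  moreover have "continuous_map X X (f ^^ k)" if "continuous_map X X f" for f and k :: nat
  proof (induction k)
    case (Suc k)
    then show ?case
      using continuous_map_compose[OF Suc that] by (simp add: o_def)
  qed simp
  ultimately show ?thesis
    using homeomorphic_imp_continuous_map[OF assms] by (simp add: int_iter_def)
qed

section \<open>Almost periodicity and equicontinuity\<close>

text \<open>
  Write \<open>h\<^sup>n = h\<^sup>i h\<^sup>k\<close> with \<open>i\<close> an almost period in \<open>[n - N, n]\<close> and hence \<open>0 \<le> k \<le> N\<close>. The map \<open>h\<^sup>i\<close>
  moves points by less than \<open>\<epsilon> / 3\<close>, and one \<open>\<delta>\<close> serves all the finitely many \<open>h\<^sup>k\<close>.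
\<close>

lemma almost_periodic_imp_equicontinuous:
  assumes ap: "almost_periodic_homeomorphism S d h"
    and comp: "compact_space (Metric_space.mtopology S d)"
    and "\<epsilon> > 0"
  shows "\<exists>\<delta>>0. \<forall>x\<in>S. \<forall>y\<in>S. d x y < \<delta> \<longrightarrow> (\<forall>n. d (int_iter S h n x) (int_iter S h n y) < \<epsilon>)"
proof -
  interpret Metric_space S d
    using ap by (simp add: almost_periodic_homeomorphism_def)
  have hom: "homeomorphic_map mtopology mtopology h"
    using ap by (simp add: almost_periodic_homeomorphism_def)
  note bij = homeomorphic_map_imp_bij[OF hom, simplified]
  obtain N :: int where N: "\<And>M. \<exists>i. M \<le> i \<and> i \<le> M + N \<and> (\<forall>x\<in>S. d (int_iter S h i x) x < \<epsilon> / 3)"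
    using ap \<open>\<epsilon> > 0\<close> unfolding almost_periodic_homeomorphism_def
    by (metis zero_less_divide_iff zero_less_numeral)
  have "\<exists>\<delta>>0. \<forall>x\<in>S. \<forall>y\<in>S. d x y < \<delta> \<longrightarrow> d (int_iter S h k x) (int_iter S h k y) < \<epsilon> / 3" for k
  proof -
    have "uniformly_continuous_map (metric (S, d)) (metric (S, d)) (int_iter S h k)"
      using continuous_map_int_iter[OF hom, of k] comp
      by (intro continuous_imp_uniformly_continuous_map) simp
    then show ?thesis
      using \<open>\<epsilon> > 0\<close> unfolding uniformly_continuous_map_def
      by (metis commute divide_pos_pos mdist_metric mspace_metric zero_less_numeral)
  qed
  then obtain \<delta> where \<delta>0: "\<And>k. \<delta> k > 0" and \<delta>: "\<And>k x y. x \<in> S \<Longrightarrow> y \<in> S \<Longrightarrow> d x y < \<delta> k \<Longrightarrow>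
      d (int_iter S h k x) (int_iter S h k y) < \<epsilon> / 3"
    by metis
  define \<delta>' where "\<delta>' = Min (insert 1 (\<delta> ` {0..N}))"
  have "\<delta>' > 0"
    using \<delta>0 by (simp add: \<delta>'_def)
  moreover have "d (int_iter S h n x) (int_iter S h n y) < \<epsilon>"
    if "x \<in> S" "y \<in> S" "d x y < \<delta>'" for x y n
  proof -
    obtain i where i: "n - N \<le> i" "i \<le> n" "\<And>x. x \<in> S \<Longrightarrow> d (int_iter S h i x) x < \<epsilon> / 3"
      using N[of "n - N"] by auto
    define k where "k = n - i"
    have in_S: "int_iter S h j z \<in> S" if "z \<in> S" for j z
      using int_iter_in[OF bij that] .
    have split: "int_iter S h n z = int_iter S h i (int_iter S h k z)" if "z \<in> S" for z
      using int_iter_add[OF bij that, of i k] by (simp add: k_def)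
    have "\<delta>' \<le> \<delta> k"
      unfolding \<delta>'_def k_def using i by (intro Min_le) auto
    then have "d (int_iter S h k x) (int_iter S h k y) < \<epsilon> / 3"
      using \<delta> that by force
    moreover have "d (int_iter S h n x) (int_iter S h k x) < \<epsilon> / 3"
      "d (int_iter S h k y) (int_iter S h n y) < \<epsilon> / 3"
      using i(3) split in_S that commute by metis+
    moreover have "d (int_iter S h n x) (int_iter S h n y)
        \<le> d (int_iter S h n x) (int_iter S h k x) + d (int_iter S h k x) (int_iter S h n y)"
      "d (int_iter S h k x) (int_iter S h n y)
        \<le> d (int_iter S h k x) (int_iter S h k y) + d (int_iter S h k y) (int_iter S h n y)"
      by (intro triangle in_S that)+
    ultimately show ?thesis
      by linarith
  qed
  ultimately show ?thesis
    by blast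
qed

section \<open>Orbit closures\<close>

context
  fixes X :: "'a topology" and h :: "'a \<Rightarrow> 'a"
  assumes metrizable: "metrizable_space X"
    and cap: "compactly_almost_periodic X h"
begin

abbreviation iter :: "int \<Rightarrow> 'a \<Rightarrow> 'a"
  where "iter \<equiv> int_iter (topspace X) h"

abbreviation invariant_hull :: "'a set \<Rightarrow> 'a set"
  where "invariant_hull B \<equiv> X closure_of (\<Union>n. iter n ` B)"

lemma homeomorphic_map_self: "homeomorphic_map X X h"
  using cap by (simp add: compactly_almost_periodic_def)

lemma bij_betw_topspace: "bij_betw h (topspace X) (topspace X)"
  using homeomorphic_map_imp_bij[OF homeomorphic_map_self] .

lemma iter_in_topspace: "x \<in> topspace X \<Longrightarrow> iter n x \<in> topspace X"
  using int_iter_in[OF bij_betw_topspace] .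

text \<open>
  The metric depends on \<open>A\<close>. This does no harm: each later argument takes place within a
  single compact invariant set.
\<close>

lemma invariant_compact_equicontinuous:
  assumes "compactin X A" "h ` A = A"
  obtains m where "mspace m = A" "mtopology_of m = subtopology X A"
    "\<And>\<epsilon>. \<epsilon> > 0 \<Longrightarrow>
      \<exists>\<delta>>0. \<forall>x\<in>A. \<forall>y\<in>A. mdist m x y < \<delta> \<longrightarrow> (\<forall>n. mdist m (iter n x) (iter n y) < \<epsilon>)"
proof -
  obtain d where d: "Metric_space A d" "Metric_space.mtopology A d = subtopology X A"
    "almost_periodic_homeomorphism A d h"
    using cap assms unfolding compactly_almost_periodic_def by blast
  interpret Metric_space A d by (fact d)
  have "compact_space mtopology"
    using assms d by (simp add: compact_space_subtopology)
  note almost_periodic_imp_equicontinuous[OF d(3) this]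
  moreover have "int_iter A h n x = iter n x" if "x \<in> A" for n x
    using int_iter_subset[OF bij_betw_topspace _ assms(2) that] assms compactin_subset_topspace by metis
  ultimately show ?thesis
    using d by (intro that[of "metric (A, d)"]) simp_all
qed

lemma invariant_hull_properties:
  assumes "compactin X B"
  shows "compactin X (invariant_hull B)" "h ` invariant_hull B = invariant_hull B"
    "B \<subseteq> invariant_hull B"
proof -
  show "compactin X (invariant_hull B)"
    using cap assms unfolding compactly_almost_periodic_def by blast
  have B: "B \<subseteq> topspace X"
    using assms compactin_subset_topspace by blast
  then have sub: "(\<Union>n. iter n ` B) \<subseteq> topspace X"
    using iter_in_topspace by blast
  have "h ` (\<Union>n. iter n ` B) = (\<Union>n. iter (n + 1) ` B)"
    using B int_iter_Suc[OF bij_betw_topspace] by (auto simp: image_iff subset_iff)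
  also have "\<dots> = (\<Union>n. iter n ` B)"
  proof (intro equalityI UN_least)
    show "iter n ` B \<subseteq> (\<Union>n. iter (n + 1) ` B)" for n
      using UN_upper[of "n - 1" UNIV "\<lambda>n. iter (n + 1) ` B"] by simp
  qed blast
  finally show "h ` invariant_hull B = invariant_hull B"
    using homeomorphic_map_closure_of[OF homeomorphic_map_self sub] by simp
  have "B \<subseteq> (\<Union>n. iter n ` B)"
    using UN_upper[of 0 UNIV "\<lambda>n. iter n ` B"] by (simp add: int_iter_0[OF bij_betw_topspace])
  then show "B \<subseteq> invariant_hull B"
    using closure_of_subset[OF sub] by (rule order_trans)
qed

lemma orbit_closure_eq_hull: "orbit_closure X h x = invariant_hull {x}"
proof -
  have "{iter n x |n. True} = (\<Union>n. iter n ` {x})"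
    by auto
  then show ?thesis
    by (simp only: orbit_closure_def)
qed

lemma orbit_closure_properties:
  assumes "x \<in> topspace X"
  shows "compactin X (orbit_closure X h x)"
    "h ` orbit_closure X h x = orbit_closure X h x" "x \<in> orbit_closure X h x"
  using invariant_hull_properties[of "{x}"] assms by (auto simp: orbit_closure_eq_hull)

lemma closedin_orbit_closure: "closedin X (orbit_closure X h x)"
  by (simp add: orbit_closure_def)

lemma iter_in_orbit_closure: "x \<in> topspace X \<Longrightarrow> iter n x \<in> orbit_closure X h x"
  using int_iter_subset(2)[OF bij_betw_topspace _ orbit_closure_properties(2,3)] closedin_orbit_closure
    closedin_subset by metis

lemma orbit_closure_minimal:
  assumes "closedin X A" "h ` A = A" "x \<in> A"
  shows "orbit_closure X h x \<subseteq> A"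
  unfolding orbit_closure_def
proof (rule closure_of_minimal)
  show "{iter n x |n. True} \<subseteq> A"
    using int_iter_subset(2)[OF bij_betw_topspace closedin_subset assms(2,3)] assms(1) by blast
qed (fact assms)

text \<open>
  Equicontinuity speaks of the metric \<open>m\<close> of a compact invariant set, whereas orbit closures are
  taken in \<open>X\<close>; as \<open>A\<close> is closed, both give the same closure of an orbit in \<open>A\<close>.
\<close>

lemma in_orbit_closure_iff:
  assumes "closedin X A" "h ` A = A" "x \<in> A"
    and m: "mspace m = A" "mtopology_of m = subtopology X A"
  shows "y \<in> orbit_closure X h x \<longleftrightarrow> y \<in> A \<and> (\<forall>\<epsilon>>0. \<exists>n. mdist m y (iter n x) < \<epsilon>)"
proof -
  let ?O = "{iter n x |n. True}"
  have O: "?O \<subseteq> A"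
    using int_iter_subset(2)[OF bij_betw_topspace closedin_subset assms(2,3)] assms(1) by blast
  interpret m: Metric_space A "mdist m"
    using Metric_space_mspace_mdist m(1) by metis
  have mtop: "m.mtopology = subtopology X A"
    using m by (simp add: mtopology_of_def)
  have "orbit_closure X h x = A \<inter> X closure_of ?O"
    using orbit_closure_minimal[OF assms(1-3)] by (auto simp: orbit_closure_def)
  also have "\<dots> = m.mtopology closure_of ?O"
    using O by (simp add: mtop closure_of_subtopology Int_absorb1)
  also have "\<dots> = {y \<in> A. \<forall>\<epsilon>>0. \<exists>z\<in>?O. mdist m y z < \<epsilon>}"
    using O unfolding m.metric_closure_of m.in_mball by blast
  finally show ?thesis
    by blast
qed

text \<open>
  If \<open>h\<^sup>n x\<close> is close to \<open>y\<close>, then applying \<open>h\<^bsup>-n\<^esup>\<close> gives that \<open>x\<close> is close to \<open>h\<^bsup>-n\<^esup> y\<close>, uniformly in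
  \<open>n\<close> by equicontinuity on the orbit closure of \<open>x\<close>.
\<close>

lemma orbit_closure_sym:
  assumes "x \<in> topspace X" "y \<in> orbit_closure X h x"
  shows "x \<in> orbit_closure X h y"
proof -
  let ?A = "orbit_closure X h x"
  note A = orbit_closure_properties[OF assms(1)]
  obtain m where m: "mspace m = ?A" "mtopology_of m = subtopology X ?A"
    and equi: "\<And>\<epsilon>. \<epsilon> > 0 \<Longrightarrow>
      \<exists>\<delta>>0. \<forall>x\<in>?A. \<forall>y\<in>?A. mdist m x y < \<delta> \<longrightarrow> (\<forall>n. mdist m (iter n x) (iter n y) < \<epsilon>)"
    using invariant_compact_equicontinuous[OF A(1,2)] by blast
  have "\<exists>n. mdist m x (iter n y) < \<epsilon>" if \<epsilon>: "\<epsilon> > 0" for \<epsilon>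
  proof -
    obtain \<delta> where "\<delta> > 0" and
      \<delta>: "\<And>u v n. u \<in> ?A \<Longrightarrow> v \<in> ?A \<Longrightarrow> mdist m u v < \<delta> \<Longrightarrow> mdist m (iter n u) (iter n v) < \<epsilon>"
      using equi[OF \<epsilon>] by blast
    obtain n where n: "mdist m y (iter n x) < \<delta>"
      using in_orbit_closure_iff[OF closedin_orbit_closure A(2,3) m] assms \<open>\<delta> > 0\<close> by blast
    have "mdist m (iter (- n) y) (iter (- n) (iter n x)) < \<epsilon>"
      using \<delta>[OF assms(2) iter_in_orbit_closure[OF assms(1)] n] .
    moreover have "iter (- n) (iter n x) = x"
      using int_iter_add[OF bij_betw_topspace assms(1), of "- n" n] int_iter_0[OF bij_betw_topspace] by simp
    ultimately show ?thesis
      by (metis mdist_commute)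
  qed
  then show ?thesis
    using in_orbit_closure_iff[OF closedin_orbit_closure A(2) assms(2) m] A(3) by blast
qed

lemma orbit_closure_eq:
  assumes "x \<in> topspace X" "y \<in> orbit_closure X h x"
  shows "orbit_closure X h y = orbit_closure X h x"
proof -
  have y: "y \<in> topspace X"
    using assms closedin_orbit_closure closedin_subset by blast
  show ?thesis
    using orbit_closure_minimal[OF closedin_orbit_closure orbit_closure_properties(2)]
      orbit_closure_sym[OF assms] assms y by (meson subset_antisym)
qed

section \<open>The decomposition is continuous\<close>

abbreviation orbit_decomposition :: "'a set set"
  where "orbit_decomposition \<equiv> orbit_closure X h ` topspace X"

lemma decomposition_orbit_closures: "decomposition X orbit_decomposition"
  unfolding decomposition_def partition_on_def disjoint_def
proof (intro conjI ballI impI)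
  show "\<Union> orbit_decomposition = topspace X"
    using closedin_orbit_closure closedin_subset orbit_closure_properties(3) by fastforce
  show "{} \<notin> orbit_decomposition"
    using orbit_closure_properties(3) by blast
  show "A \<inter> B = {}" if "A \<in> orbit_decomposition" "B \<in> orbit_decomposition" "A \<noteq> B" for A B
    using that orbit_closure_eq by blast
qed (auto simp: closedin_orbit_closure)

lemma decomposition_map_orbit_closures:
  "x \<in> topspace X \<Longrightarrow> decomposition_map orbit_decomposition x = orbit_closure X h x"
  using decomposition_map_eq[OF decomposition_orbit_closures] orbit_closure_properties(3) by blast

text \<open>
  As the topology on the decomposition is the quotient topology, openness and closedness of the
  quotient map are statements about such saturations.
\<close>

lemma saturation_eq:
  assumes "C \<subseteq> topspace X"
  shows "{x \<in> topspace X. decomposition_map orbit_decomposition x \<in>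
      decomposition_map orbit_decomposition ` C} = {x \<in> topspace X. orbit_closure X h x \<inter> C \<noteq> {}}"
    (is "?L = ?R")
proof (intro equalityI subsetI)
  fix x assume "x \<in> ?L"
  then obtain c where "x \<in> topspace X" "c \<in> C" "orbit_closure X h x = orbit_closure X h c"
    using assms by (auto simp: decomposition_map_orbit_closures subset_iff)
  then show "x \<in> ?R"
    using orbit_closure_properties(3)[of c] assms by auto
next
  fix x assume "x \<in> ?R"
  then obtain c where "x \<in> topspace X" "c \<in> C" "c \<in> orbit_closure X h x"
    by blast
  then have "decomposition_map orbit_decomposition x = decomposition_map orbit_decomposition c"
    using assms orbit_closure_eq[of x c] by (auto simp: decomposition_map_orbit_closures)
  with \<open>x \<in> topspace X\<close> \<open>c \<in> C\<close> show "x \<in> ?L"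
    by blast
qed

lemma decomposition_map_image_subset:
  assumes "C \<subseteq> topspace X"
  shows "decomposition_map orbit_decomposition ` C
    \<subseteq> topspace (decomposition_topology X orbit_decomposition)"
  using quotient_map_decomposition_map[OF decomposition_orbit_closures] assms
  unfolding quotient_map_def by blast

text \<open>
  An open set meeting the closure of an orbit meets the orbit itself.
\<close>

lemma open_map_orbit_closures:
  "open_map X (decomposition_topology X orbit_decomposition) (decomposition_map orbit_decomposition)"
  unfolding open_map_def
proof (intro allI impI)
  fix U assume U: "openin X U"
  then have sub: "U \<subseteq> topspace X"
    by (rule openin_subset)
  have saturation: "{x \<in> topspace X. orbit_closure X h x \<inter> U \<noteq> {}} = (\<Union>n. {x \<in> topspace X. iter n x \<in> U})"
  proof (intro equalityI subsetI)
    fix x assume "x \<in> {x \<in> topspace X. orbit_closure X h x \<inter> U \<noteq> {}}"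
    then obtain y where "x \<in> topspace X" "y \<in> U" "y \<in> X closure_of {iter n x |n. True}"
      unfolding orbit_closure_def by blast
    then show "x \<in> (\<Union>n. {x \<in> topspace X. iter n x \<in> U})"
      using U unfolding in_closure_of by blast
  next
    fix x assume "x \<in> (\<Union>n. {x \<in> topspace X. iter n x \<in> U})"
    then show "x \<in> {x \<in> topspace X. orbit_closure X h x \<inter> U \<noteq> {}}"
      using iter_in_orbit_closure by blast
  qed
  have "openin X (\<Union>n. {x \<in> topspace X. iter n x \<in> U})"
    using U openin_continuous_map_preimage[OF continuous_map_int_iter[OF homeomorphic_map_self]] by blast
  then have "openin X {x \<in> topspace X. decomposition_map orbit_decomposition x \<in>
      decomposition_map orbit_decomposition ` U}"
    by (simp only: saturation_eq[OF sub] saturation)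
  then show "openin (decomposition_topology X orbit_decomposition)
      (decomposition_map orbit_decomposition ` U)"
    by (rule iffD1[OF quotient_map_decomposition_map[OF decomposition_orbit_closures,
          unfolded quotient_map_def, THEN conjunct2, rule_format,
          OF decomposition_map_image_subset[OF sub]]])
qed

text \<open>
  Let \<open>\<sigma> n\<close> converge to \<open>x\<close> with points \<open>c n\<close> of \<open>C\<close> in the orbit closures. The invariant hull \<open>A\<close> of the
  sequence together with its limit is compact, so a subsequence of \<open>c\<close> converges to some \<open>l\<close> in \<open>C\<close>.
  For large \<open>n\<close> along it, the point \<open>l\<close> is close to \<open>c n\<close>, which is close to some \<open>h\<^sup>k (\<sigma> n)\<close>, which by
  equicontinuity on \<open>A\<close> is close to \<open>h\<^sup>k x\<close>, whatever \<open>k\<close> is.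
\<close>

lemma closedin_saturation:
  assumes C: "closedin X C"
  shows "closedin X {x \<in> topspace X. orbit_closure X h x \<inter> C \<noteq> {}}" (is "closedin X ?S")
proof -
  obtain M d where "Metric_space M d" and X: "X = Metric_space.mtopology M d"
    using metrizable unfolding metrizable_space_def by blast
  then interpret M: Metric_space M d by blast
  have "x \<in> ?S" if \<sigma>: "range \<sigma> \<subseteq> ?S" and lim: "limitin X \<sigma> x sequentially" for \<sigma> x
  proof -
    define B where "B = insert x (range \<sigma>)"
    have "compactin X B"
      unfolding B_def using \<sigma> by (intro compactin_sequence_with_limit[OF lim]) auto
    define A where "A = invariant_hull B"
    note A = invariant_hull_properties[OF \<open>compactin X B\<close>, folded A_def]
    have closedA: "closedin X A"
      by (simp add: A_def)
    obtain m where m: "mspace m = A" "mtopology_of m = subtopology X A"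
      and equi: "\<And>\<epsilon>. \<epsilon> > 0 \<Longrightarrow>
        \<exists>\<delta>>0. \<forall>x\<in>A. \<forall>y\<in>A. mdist m x y < \<delta> \<longrightarrow> (\<forall>n. mdist m (iter n x) (iter n y) < \<epsilon>)"
      using invariant_compact_equicontinuous[OF A(1,2)] by blast
    interpret m: Metric_space A "mdist m"
      using Metric_space_mspace_mdist m(1) by metis
    have mtop: "m.mtopology = subtopology X A"
      using m by (simp add: mtopology_of_def)
    have xA: "x \<in> A" and \<sigma>A: "\<And>n. \<sigma> n \<in> A"
      using A(3) by (auto simp: B_def)
    have iterA: "iter n a \<in> A" if "a \<in> A" for n a
      using int_iter_subset(2)[OF bij_betw_topspace closedin_subset[OF closedA] A(2) that] .
    have "\<exists>c. c \<in> orbit_closure X h (\<sigma> n) \<and> c \<in> C" for n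
      using \<sigma> by blast
    then obtain c where c: "\<And>n. c n \<in> orbit_closure X h (\<sigma> n)" "\<And>n. c n \<in> C"
      by metis
    have cA: "c n \<in> A" for n
      using c(1) orbit_closure_minimal[OF closedA A(2) \<sigma>A] by blast
    have "compact_space m.mtopology"
      using A(1) mtop by (simp add: compact_space_subtopology)
    then obtain l r where "l \<in> A" "strict_mono (r :: nat \<Rightarrow> nat)"
      and l: "limitin m.mtopology (c \<circ> r) l sequentially"
      using cA unfolding m.compact_space_sequentially by (meson image_subsetI)
    have "limitin X (c \<circ> r) l sequentially"
      using l mtop by (simp add: limitin_subtopology)
    then have "l \<in> C"
      using limitin_closedin[OF _ C] c(2) by fastforce
    have lim': "limitin m.mtopology (\<sigma> \<circ> r) x sequentially"
      using limitin_subsequence[OF \<open>strict_mono r\<close> lim] mtop xA \<sigma>A by (simp add: limitin_subtopology)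
    have "\<exists>k. mdist m l (iter k x) < \<epsilon>" if "\<epsilon> > 0" for \<epsilon>
    proof -
      obtain \<delta> where "\<delta> > 0" and \<delta>: "\<And>u v n. u \<in> A \<Longrightarrow> v \<in> A \<Longrightarrow> mdist m u v < \<delta> \<Longrightarrow>
          mdist m (iter n u) (iter n v) < \<epsilon> / 3"
        using equi[of "\<epsilon> / 3"] \<open>\<epsilon> > 0\<close> by auto
      have "\<forall>\<^sub>F n in sequentially. mdist m (\<sigma> (r n)) x < \<delta>"
        using lim' \<open>\<delta> > 0\<close> unfolding m.limitin_metric
        by (auto elim!: allE[of _ \<delta>] eventually_mono)
      moreover have "\<forall>\<^sub>F n in sequentially. mdist m (c (r n)) l < \<epsilon> / 3"
        using l \<open>\<epsilon> > 0\<close> unfolding m.limitin_metric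
        by (auto elim!: allE[of _ "\<epsilon> / 3"] eventually_mono)
      ultimately obtain n where n: "mdist m (\<sigma> (r n)) x < \<delta>" "mdist m (c (r n)) l < \<epsilon> / 3"
        using eventually_happens[OF eventually_conj] by force
      obtain k where k: "mdist m (c (r n)) (iter k (\<sigma> (r n))) < \<epsilon> / 3"
        using c(1)[of "r n"] \<open>\<epsilon> > 0\<close> in_orbit_closure_iff[OF closedA A(2) \<sigma>A m]
        by (metis divide_pos_pos zero_less_numeral)
      have "mdist m l (iter k x) \<le> mdist m l (c (r n)) + mdist m (c (r n)) (iter k (\<sigma> (r n)))
          + mdist m (iter k (\<sigma> (r n))) (iter k x)"
        using m.triangle[of l "c (r n)" "iter k x"]
          m.triangle[of "c (r n)" "iter k (\<sigma> (r n))" "iter k x"] \<open>l \<in> A\<close> cA iterA \<sigma>A xA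
        by (smt (verit))
      also have "\<dots> < \<epsilon>"
        using n k \<delta>[OF \<sigma>A xA n(1), of k] by (simp add: mdist_commute)
      finally show ?thesis ..
    qed
    then have "l \<in> orbit_closure X h x"
      using in_orbit_closure_iff[OF closedA A(2) xA m] \<open>l \<in> A\<close> by blast
    with \<open>l \<in> C\<close> show ?thesis
      using limitin_topspace[OF lim] by blast
  qed
  moreover have "?S \<subseteq> M"
    by (auto simp: X)
  ultimately show ?thesis
    unfolding M.metric_closedin_iff_sequentially_closed[of ?S, folded X] by blast
qed

lemma closed_map_orbit_closures:
  "closed_map X (decomposition_topology X orbit_decomposition) (decomposition_map orbit_decomposition)"
  unfolding closed_map_def
proof (intro allI impI)
  fix C assume C: "closedin X C"
  then have sub: "C \<subseteq> topspace X"
    by (rule closedin_subset)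
  have "closedin X {x \<in> topspace X. decomposition_map orbit_decomposition x \<in>
      decomposition_map orbit_decomposition ` C}"
    unfolding saturation_eq[OF sub] by (rule closedin_saturation[OF C])
  then show "closedin (decomposition_topology X orbit_decomposition)
      (decomposition_map orbit_decomposition ` C)"
    by (rule iffD1[OF quotient_map_decomposition_map[OF decomposition_orbit_closures,
          unfolded quotient_map_closedin, THEN conjunct2, rule_format,
          OF decomposition_map_image_subset[OF sub]]])
qed

section \<open>The group structure on an orbit closure\<close>

text \<open>
  The orbit, parametrized by the integers, is dense in the compact and hence complete orbit
  closure; translating the parameter is applying an iterate, so equicontinuity of the iterates is
  exactly the hypothesis on translations.
\<close>

lemma orbit_closure_group:
  assumes x: "x \<in> topspace X"
  shows "\<exists>G :: 'a monoid. abelian_topological_group G (subtopology X (orbit_closure X h x))"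
proof -
  let ?A = "orbit_closure X h x"
  note A = orbit_closure_properties[OF x]
  obtain m where m: "mspace m = ?A" "mtopology_of m = subtopology X ?A"
    and equi: "\<And>\<epsilon>. \<epsilon> > 0 \<Longrightarrow>
      \<exists>\<delta>>0. \<forall>x\<in>?A. \<forall>y\<in>?A. mdist m x y < \<delta> \<longrightarrow> (\<forall>n. mdist m (iter n x) (iter n y) < \<epsilon>)"
    using invariant_compact_equicontinuous[OF A(1,2)] by blast
  have "\<exists>G :: 'a monoid. abelian_topological_group G (mtopology_of m)"
  proof (rule abelian_topological_group_from_dense_image[of m "\<lambda>n. iter n x"])
    show "mcomplete_of m"
      using A(1) m Metric_space.compact_space_imp_mcomplete[OF Metric_space_mspace_mdist, of m]
      by (simp add: mcomplete_of_def mtopology_of_def compact_space_subtopology)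
    show "iter a x \<in> mspace m" for a
      using iter_in_orbit_closure[OF x] m by simp
    have "X closure_of range (\<lambda>n. iter n x) = ?A"
      by (simp add: orbit_closure_def full_SetCompr_eq)
    moreover have "range (\<lambda>n. iter n x) \<subseteq> ?A"
      using iter_in_orbit_closure[OF x] by blast
    ultimately show "mtopology_of m closure_of range (\<lambda>n. iter n x) = mspace m"
      by (simp add: m closure_of_subtopology Int_absorb1)
    have iter_add: "iter (a + c) x = iter c (iter a x)" for a c
      using int_iter_add[OF bij_betw_topspace x, of c a] by (simp add: add.commute)
    show "\<exists>\<delta>>0. \<forall>a b c. mdist m (iter a x) (iter b x) < \<delta> \<longrightarrow>
        mdist m (iter (a + c) x) (iter (b + c) x) < \<epsilon>" if "\<epsilon> > 0" for \<epsilon>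
      using equi[OF that] iter_in_orbit_closure[OF x] unfolding iter_add by blast
  qed
  then show ?thesis
    by (simp add: m)
qed

end

theorem theorem5:
  fixes X :: "'a topology" and h :: "'a \<Rightarrow> 'a"
  assumes "metrizable_space X"
    and "compactly_almost_periodic X h"
  shows "continuous_decomposition X (orbit_closure X h ` topspace X) \<and>
    (\<forall>A \<in> orbit_closure X h ` topspace X.
       compactin X A \<and>
       (\<exists>G :: 'a monoid. abelian_topological_group G (subtopology X A)))"
  using decomposition_orbit_closures[OF assms] open_map_orbit_closures[OF assms]
    closed_map_orbit_closures[OF assms] orbit_closure_properties(1)[OF assms]
    orbit_closure_group[OF assms]
  unfolding continuous_decomposition_def by blast

end
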